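(* Let $\mathcal{X}$ be a compact subset of $\mathbb{R}^{\mathbb{N}}$ (with the product topology). Then $\mathcal{X}$ admits detection if and only if for every probability measure $P$ on $\mathcal{X}$, if $x$ is sampled from $P$ independently of $\xi$, then the distributions of $\xi$ and $x+\xi$ are mutually singular.
   Context: Noise: $\xi=(\xi_n)_{n\in\mathbb{N}}$ is a sequence of independent standard real Gaussian random variables. A set $\mathcal{X}\subset\mathbb{R}^{\mathbb{N}}$ admits detection if there is a Borel measurable map $T:\mathbb{R}^{\mathbb{N}}\to\{0,1\}$ such that $T(\xi)=0$ almost surely and, for every $x\in\mathcal{X}$, $T(x+\xi)=1$ almost surely. Probability measures are Borel. *)

theory Defs
  imports "HOL-Probability.Probability"
begin

text \<open>
  The space of real sequences is the type \<^typ>\<open>nat \<Rightarrow> real\<close>; its library topology is the product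
  topology, and \<^term>\<open>borel :: (nat \<Rightarrow> real) measure\<close> is the Borel sigma-algebra of that topology.
\<close>

definition gaussian_noise :: "'a measure \<Rightarrow> (nat \<Rightarrow> 'a \<Rightarrow> real) \<Rightarrow> bool" where
  "gaussian_noise M \<xi> \<longleftrightarrow>
     prob_space M \<and>
     prob_space.indep_vars M (\<lambda>_. borel) \<xi> UNIV \<and>
     (\<forall>n. distributed M lborel (\<xi> n) std_normal_density)"

definition admits_detection ::
    "'a measure \<Rightarrow> (nat \<Rightarrow> 'a \<Rightarrow> real) \<Rightarrow> (nat \<Rightarrow> real) set \<Rightarrow> bool" where
  "admits_detection M \<xi> X \<longleftrightarrow>
     (\<exists>T :: (nat \<Rightarrow> real) \<Rightarrow> nat. T \<in> borel \<rightarrow>\<^sub>M count_space {0, 1} \<and>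
        (AE \<omega> in M. T (\<lambda>n. \<xi> n \<omega>) = 0) \<and>
        (\<forall>x\<in>X. AE \<omega> in M. T (\<lambda>n. x n + \<xi> n \<omega>) = 1))"

definition borel_prob_on :: "'b::topological_space set \<Rightarrow> 'b measure \<Rightarrow> bool" where
  "borel_prob_on X P \<longleftrightarrow> prob_space P \<and> sets P = sets (restrict_space borel X)"

text \<open>Meant for measures on a common sigma-algebra.\<close>

definition mutually_singular :: "'b measure \<Rightarrow> 'b measure \<Rightarrow> bool" where
  "mutually_singular \<mu> \<nu> \<longleftrightarrow>
     (\<exists>A\<in>sets \<mu>. emeasure \<mu> A = 0 \<and> emeasure \<nu> (space \<nu> - A) = 0)"

definition noise_dist :: "'a measure \<Rightarrow> (nat \<Rightarrow> 'a \<Rightarrow> real) \<Rightarrow> (nat \<Rightarrow> real) measure" where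
  "noise_dist M \<xi> = distr M borel (\<lambda>\<omega> n. \<xi> n \<omega>)"

text \<open>
  Sampling \<open>x\<close> from \<open>P\<close> independently of \<open>\<xi>\<close> takes place on the product space of \<open>P\<close> and \<open>M\<close>:
  there the first coordinate has distribution \<open>P\<close> and is independent of the noise, which is a
  function of the second coordinate.
\<close>

definition signal_plus_noise_dist ::
    "'a measure \<Rightarrow> (nat \<Rightarrow> 'a \<Rightarrow> real) \<Rightarrow> (nat \<Rightarrow> real) measure \<Rightarrow> (nat \<Rightarrow> real) measure" where
  "signal_plus_noise_dist M \<xi> P = distr (P \<Otimes>\<^sub>M M) borel (\<lambda>(x, \<omega>) n. x n + \<xi> n \<omega>)"

end

theory Submission
  imports Defs "HOL-Real_Asymp.Real_Asymp"
begin

text \<open>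
  If \<open>T\<close> detects \<open>X\<close>, then by Fubini the event \<open>T = 1\<close> separates the two laws. Conversely, it suffices
  to find, for every \<open>e > 0\<close>, a continuous \<open>\<phi>\<close> with values in \<open>[0, 1]\<close> whose expectation at \<open>\<xi>\<close> is at
  most \<open>e\<close> and whose expectation at \<open>x + \<xi>\<close> is at least \<open>1 - e\<close> for all \<open>x \<in> X\<close> simultaneously: by
  Borel-Cantelli, a sequence of such tests with summable errors detects \<open>X\<close> through the event that
  it converges to 1. The order of quantifiers is exchanged by a minimax argument. If no such
  \<open>\<phi>\<close> exists, then Blackwell's approachability strategy, played against a countable family of tests
  that is rich enough to separate compact sets, yields empirical measures on \<open>X\<close> against which
  finitely many tests fail up to an arbitrarily small error. By compactness they have a weak limit
  \<open>P\<close>, against which every test of the family fails, contradicting the singularity for \<open>P\<close>. The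
  weak limit comes from Helly's theorem on the line, after writing \<open>X\<close> as a continuous image of a
  compact set of reals by means of binary digits.
\<close>

section \<open>Blackwell approachability\<close>

text \<open>
  Blackwell's strategy: respond to the positive part of the accumulated payoff vector. Then the cross
  term in its squared norm is nonpositive, so the norm grows only like the square root of time.
\<close>

lemma approachability:
  fixes u :: "nat \<Rightarrow> 'b \<Rightarrow> real"
  assumes bound: "\<And>i x. i < k \<Longrightarrow> x \<in> X \<Longrightarrow> \<bar>u i x\<bar> \<le> B"
    and response: "\<And>w. (\<And>i. 0 \<le> w i) \<Longrightarrow> \<exists>x\<in>X. (\<Sum>i<k. w i * u i x) \<le> 0"
    and "\<delta> > 0"
  shows "\<exists>N xs. N > 0 \<and> (\<forall>t. xs t \<in> X) \<and> (\<forall>i<k. (\<Sum>t<N. u i (xs t)) \<le> \<delta> * real N)"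
proof -
  define r where "r S = (SOME x. x \<in> X \<and> (\<Sum>i<k. max 0 (S i) * u i x) \<le> 0)" for S :: "nat \<Rightarrow> real"
  have r: "r S \<in> X" "(\<Sum>i<k. max 0 (S i) * u i (r S)) \<le> 0" for S
    using someI_ex[of "\<lambda>x. x \<in> X \<and> (\<Sum>i<k. max 0 (S i) * u i x) \<le> 0"]
      response[of "\<lambda>i. max 0 (S i)"] unfolding r_def by auto
  define S where "S = rec_nat (\<lambda>i. 0) (\<lambda>_ s i. s i + u i (r s))"
  have S0: "S 0 = (\<lambda>i. 0)" and SSuc: "S (Suc t) = (\<lambda>i. S t i + u i (r (S t)))" for t
    by (simp_all add: S_def)
  have S_sum: "S n i = (\<Sum>t<n. u i (r (S t)))" for n i
    by (induction n) (simp_all add: S0 SSuc)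
  have energy: "(\<Sum>i<k. (max 0 (S n i))\<^sup>2) \<le> real n * (real k * B\<^sup>2)" for n
  proof (induction n)
    case 0
    then show ?case by (simp add: S0)
  next
    case (Suc n)
    let ?u = "\<lambda>i. u i (r (S n))"
    have step: "(max 0 (S (Suc n) i))\<^sup>2 \<le> (max 0 (S n i))\<^sup>2 + 2 * (max 0 (S n i) * ?u i) + B\<^sup>2"
      if "i < k" for i
    proof -
      \<comment> \<open>For \<open>s\<close> the old coordinate and \<open>u\<close> its increment,
        \<open>max 0 (s + u)\<close> is at most the absolute value of \<open>max 0 s + u\<close>:
        when \<open>s + u\<close> is positive, it is bounded by \<open>max 0 s + u\<close>.\<close>
      have "(max 0 (S (Suc n) i))\<^sup>2 \<le> (max 0 (S n i) + ?u i)\<^sup>2"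
        unfolding SSuc by (rule abs_le_square_iff[THEN iffD1]) auto
      moreover have "(?u i)\<^sup>2 \<le> B\<^sup>2"
        using bound[OF that r(1)[of "S n"]] by (intro abs_le_square_iff[THEN iffD1]) linarith
      ultimately show ?thesis by (simp add: power2_sum)
    qed
    have "(\<Sum>i<k. (max 0 (S (Suc n) i))\<^sup>2)
        \<le> (\<Sum>i<k. (max 0 (S n i))\<^sup>2 + 2 * (max 0 (S n i) * ?u i) + B\<^sup>2)"
      using step by (intro sum_mono) auto
    also have "\<dots> = (\<Sum>i<k. (max 0 (S n i))\<^sup>2) + 2 * (\<Sum>i<k. max 0 (S n i) * ?u i) + real k * B\<^sup>2"
      by (simp add: sum.distrib sum_distrib_left)
    also have "\<dots> \<le> real (Suc n) * (real k * B\<^sup>2)"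
      using Suc r(2)[of "S n"] by (simp add: algebra_simps)
    finally show ?case .
  qed
  \<comment> \<open>Chosen so that the energy bound \<open>N * (k * B\<^sup>2)\<close> is at most
    \<open>(\<delta> * N)\<^sup>2\<close>; the energy dominates the square of each single
    coordinate.\<close>
  obtain N where N: "real N > real k * B\<^sup>2 / \<delta>\<^sup>2" using reals_Archimedean2 by blast
  then have "real N > 0"
    by (meson divide_nonneg_nonneg le_less_trans mult_nonneg_nonneg of_nat_0_le_iff zero_le_power2)
  have "S N i \<le> \<delta> * real N" if "i < k" for i
  proof -
    have "(max 0 (S N i))\<^sup>2 \<le> (\<Sum>i<k. (max 0 (S N i))\<^sup>2)"
      using that by (intro member_le_sum) auto
    also have "\<dots> \<le> real N * (real k * B\<^sup>2)" by (rule energy)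
    also have "\<dots> \<le> real N * (\<delta>\<^sup>2 * real N)"
      using N \<open>\<delta> > 0\<close> by (intro mult_left_mono) (auto simp: field_simps)
    also have "\<dots> = (\<delta> * real N)\<^sup>2" by (simp add: power2_eq_square)
    finally have "max 0 (S N i) \<le> \<delta> * real N"
      by (rule power2_le_imp_le) (use \<open>\<delta> > 0\<close> in simp)
    then show ?thesis by simp
  qed
  then show ?thesis
    using r(1) \<open>real N > 0\<close> by (intro exI[of _ N] exI[of _ "\<lambda>t. r (S t)"]) (auto simp: S_sum)
qed

section \<open>A countable family of tests separating compact sets\<close>

text \<open>A compact set is the decreasing intersection of its metric neighbourhoods, so these
  approximate its measure. A bump around a finite net of \<open>K\<close> fits between the
  indicators of \<open>K\<close> and of such a neighbourhood, and countably many bumps suffice when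
  the nets come from a countable dense set. The family is fixed before \<open>K\<close> and
  \<open>\<mu>\<close>, as the minimax argument requires: its measure is constructed from the
  tests.\<close>

lemma countable_test_family:
  "\<exists>\<phi> :: nat \<Rightarrow> 'b :: {metric_space, second_countable_topology} \<Rightarrow> real.
     (\<forall>i. continuous_on UNIV (\<phi> i)) \<and> (\<forall>i. range (\<phi> i) \<subseteq> {0..1}) \<and>
     (\<forall>K \<mu> e. compact K \<longrightarrow> K \<noteq> {} \<longrightarrow> finite_measure \<mu> \<longrightarrow> sets \<mu> = sets borel \<longrightarrow> e > 0 \<longrightarrow>
        (\<exists>i. (\<forall>y\<in>K. \<phi> i y = 1) \<and> (\<integral>y. \<phi> i y \<partial>\<mu>) < measure \<mu> K + e))"
proof -
  obtain S :: "'b set" where S: "countable S" "\<And>Y. open Y \<Longrightarrow> Y \<noteq> {} \<Longrightarrow> \<exists>d\<in>S. d \<in> Y"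
    using countable_dense_setE by auto
  \<comment> \<open>\<open>\<psi> (n, D)\<close> is 1 within distance \<open>1 / (n + 1)\<close> of \<open>D\<close> and 0 beyond distance \<open>2 / (n + 1)\<close>;
    for \<open>K\<close> compact, \<open>D\<close> is taken to be a finite net of \<open>K\<close>.\<close>
  define \<psi> where "\<psi> = (\<lambda>(n::nat, D::'b set) y. max 0 (min 1 (2 - (real n + 1) * infdist y D)))"
  define I where "I = (UNIV :: nat set) \<times> {D. finite D \<and> D \<subseteq> S}"
  have "countable I" "I \<noteq> {}"
    unfolding I_def using countable_Collect_finite_subset[OF S(1)] by auto
  then have I: "range (from_nat_into I) = I" by simp
  define \<phi> where "\<phi> i = \<psi> (from_nat_into I i)" for i
  have cont: "continuous_on UNIV (\<psi> p)" for p
    unfolding \<psi>_def by (cases p) (auto intro!: continuous_intros)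
  have rng: "range (\<psi> p) \<subseteq> {0..1}" for p
    unfolding \<psi>_def by (cases p) auto
  have approx: "\<exists>p\<in>I. (\<forall>y\<in>K. \<psi> p y = 1) \<and> (\<integral>y. \<psi> p y \<partial>\<mu>) < measure \<mu> K + e"
    if K: "compact K" "K \<noteq> {}" and \<mu>: "finite_measure \<mu>" and sets[measurable_cong]: "sets \<mu> = sets borel"
      and "e > 0" for K \<mu> and e :: real
  proof -
    interpret finite_measure \<mu> by fact
    have sp: "space \<mu> = UNIV" using sets_eq_imp_space_eq[OF sets] by simp
    \<comment> \<open>The constant 3 adds two distances: the net points lie within
      \<open>1 / (n + 1)\<close> of \<open>K\<close>, and the bump vanishes from distance
      \<open>2 / (n + 1)\<close> of the net onwards.\<close>
    define U where "U n = {y. infdist y K < 3 / (real n + 1)}" for n :: nat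
    have U_sets[measurable]: "U n \<in> sets \<mu>" for n
      unfolding U_def sets
      by (intro borel_open open_Collect_less continuous_intros)
    have "(\<lambda>n. measure \<mu> (U n)) \<longlonglongrightarrow> measure \<mu> (\<Inter>n. U n)"
    proof (rule finite_Lim_measure_decseq)
      show "decseq U"
      proof (rule decseq_SucI, rule subsetI)
        fix n y assume "y \<in> U (Suc n)"
        moreover have "3 / (real (Suc n) + 1) \<le> 3 / (real n + 1)" by (simp add: field_simps)
        ultimately show "y \<in> U n" unfolding U_def by simp
      qed
    qed auto
    moreover have "(\<Inter>n. U n) = K"
    proof
      show "K \<subseteq> (\<Inter>n. U n)" by (auto simp: U_def)
      show "(\<Inter>n. U n) \<subseteq> K"
      proof
        fix y assume y: "y \<in> (\<Inter>n. U n)"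
        have "(\<lambda>n. 3 / (real n + 1)) \<longlonglongrightarrow> 0" by real_asymp
        then have "infdist y K \<le> 0"
          by (rule LIMSEQ_le_const) (use y in \<open>auto simp: U_def intro!: exI[of _ 0] less_imp_le\<close>)
        then have "infdist y K = 0" using infdist_nonneg[of y K] by linarith
        then show "y \<in> K"
          using in_closed_iff_infdist_zero[OF compact_imp_closed] K by blast
      qed
    qed
    ultimately have "(\<lambda>n. measure \<mu> (U n)) \<longlonglongrightarrow> measure \<mu> K" by simp
    then have "\<forall>\<^sub>F n in sequentially. measure \<mu> (U n) < measure \<mu> K + e"
      by (rule order_tendstoD) (use \<open>e > 0\<close> in simp)
    then obtain n where n: "measure \<mu> (U n) < measure \<mu> K + e"
      using eventually_sequentially by auto
    define \<delta> where "\<delta> = 1 / (real n + 1)"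
    have "\<delta> > 0" by (simp add: \<delta>_def)
    have "K \<subseteq> (\<Union>d\<in>S. ball d \<delta>)"
    proof
      fix y assume "y \<in> K"
      obtain d where "d \<in> S" "d \<in> ball y \<delta>" using S(2)[of "ball y \<delta>"] \<open>\<delta> > 0\<close> by auto
      then show "y \<in> (\<Union>d\<in>S. ball d \<delta>)" by (auto simp: dist_commute)
    qed
    then obtain D' where D': "D' \<subseteq> S" "finite D'" "K \<subseteq> (\<Union>d\<in>D'. ball d \<delta>)"
      using compactE_image[OF K(1), of S "\<lambda>d. ball d \<delta>"] by (metis open_ball)
    \<comment> \<open>Centres far from \<open>K\<close> are discarded; otherwise the bump could be
      positive outside \<open>U n\<close>.\<close>
    define D where "D = {d\<in>D'. \<exists>y\<in>K. dist y d < \<delta>}"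
    have D: "D \<subseteq> S" "finite D" using D'(1,2) by (auto simp: D_def)
    have near: "\<exists>d\<in>D. dist y d < \<delta>" if "y \<in> K" for y
    proof -
      obtain d where "d \<in> D'" "dist y d < \<delta>" using D'(3) \<open>y \<in> K\<close> by (auto simp: dist_commute)
      then show ?thesis using that by (auto simp: D_def)
    qed
    have "D \<noteq> {}" using near K(2) by blast
    have one: "\<psi> (n, D) y = 1" if "y \<in> K" for y
    proof -
      obtain d where "d \<in> D" "dist y d < \<delta>" using near \<open>y \<in> K\<close> by blast
      then have "infdist y D < \<delta>" using infdist_le[of d D y] by linarith
      then have "(real n + 1) * infdist y D < 1" by (simp add: \<delta>_def field_simps)
      then show ?thesis by (simp add: \<psi>_def)
    qed
    have zero: "\<psi> (n, D) y = 0" if "y \<notin> U n" for y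
    proof -
      have "2 * \<delta> \<le> infdist y D"
        unfolding infdist_notempty[OF \<open>D \<noteq> {}\<close>]
      proof (rule cINF_greatest[OF \<open>D \<noteq> {}\<close>])
        fix d assume "d \<in> D"
        then obtain z where "z \<in> K" "dist z d < \<delta>" by (auto simp: D_def)
        moreover have "3 * \<delta> \<le> infdist y K" using that by (simp add: U_def \<delta>_def)
        moreover have "infdist y K \<le> dist y z" using \<open>z \<in> K\<close> by (rule infdist_le)
        ultimately show "2 * \<delta> \<le> dist y d"
          using dist_triangle[of y z d] by (simp add: dist_commute)
      qed
      then have "2 \<le> (real n + 1) * infdist y D" by (simp add: \<delta>_def field_simps)
      then show ?thesis by (simp add: \<psi>_def)
    qed
    have "(\<integral>y. \<psi> (n, D) y \<partial>\<mu>) \<le> (\<integral>y. indicator (U n) y \<partial>\<mu>)"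
    proof (rule integral_mono)
      show "integrable \<mu> (\<psi> (n, D))"
      proof (rule integrable_const_bound[where B = 1])
        show "\<psi> (n, D) \<in> borel_measurable \<mu>"
          using borel_measurable_continuous_onI[OF cont] by (simp cong: measurable_cong_sets add: sets)
      qed (use rng in \<open>auto simp: image_subset_iff\<close>)
      show "\<psi> (n, D) y \<le> indicator (U n) y" for y
        using zero[of y] rng[of "(n, D)"] by (auto simp: indicator_def image_subset_iff)
    qed (auto intro!: integrable_real_indicator simp: emeasure_eq_measure)
    also have "\<dots> = measure \<mu> (U n)" by (simp add: sp)
    finally have "(\<integral>y. \<psi> (n, D) y \<partial>\<mu>) < measure \<mu> K + e" using n by simp
    then show ?thesis using one D by (intro bexI[of _ "(n, D)"]) (auto simp: I_def)
  qed
  show ?thesis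
  proof (intro exI[of _ \<phi>] conjI allI impI)
    fix K :: "'b set" and \<mu> :: "'b measure" and e :: real
    assume "compact K" "K \<noteq> {}" "finite_measure \<mu>" "sets \<mu> = sets borel" "e > 0"
    from approx[OF this] obtain p where "p \<in> I" "\<forall>y\<in>K. \<psi> p y = 1" "(\<integral>y. \<psi> p y \<partial>\<mu>) < measure \<mu> K + e"
      by blast
    moreover obtain i where "from_nat_into I i = p" using I \<open>p \<in> I\<close> by (metis imageE)
    ultimately show "\<exists>i. (\<forall>y\<in>K. \<phi> i y = 1) \<and> (\<integral>y. \<phi> i y \<partial>\<mu>) < measure \<mu> K + e"
      unfolding \<phi>_def by metis
  qed (use cont rng in \<open>auto simp: \<phi>_def\<close>)
qed

section \<open>Compact sets of sequences as continuous images of compact sets of reals\<close>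

text \<open>The Cantor space, with real digits so that expansions need no coercion, and as a
  \<open>PiE\<close> set to match Tychonoff's theorem \<open>compactin_PiE\<close>.\<close>

definition binary_sequences :: "(nat \<Rightarrow> real) set" where
  "binary_sequences = (UNIV \<rightarrow>\<^sub>E {0, 1})"

lemma binary_sequences_iff: "b \<in> binary_sequences \<longleftrightarrow> (\<forall>n. b n = 0 \<or> b n = 1)"
  by (auto simp: binary_sequences_def PiE_iff)

lemma compact_binary_sequences: "compact binary_sequences"
  using compactin_PiE[of "\<lambda>_. euclidean" "UNIV :: nat set" "\<lambda>_. {0, 1 :: real}"]
  by (simp add: binary_sequences_def euclidean_product_topology compactin_euclidean_iff)

lemma norm_binary_term_le:
  "b \<in> binary_sequences \<Longrightarrow> 0 \<le> q \<Longrightarrow> norm (b n * q ^ n) \<le> q ^ n" for q :: real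
  using mult_left_le_one_le[of "q ^ n" "b n"] by (auto simp: binary_sequences_iff abs_mult dest: spec[of _ n])

lemma summable_binary:
  "b \<in> binary_sequences \<Longrightarrow> 0 \<le> q \<Longrightarrow> q < 1 \<Longrightarrow> summable (\<lambda>n. b n * q ^ n)" for q :: real
  by (rule summable_comparison_test'[OF summable_geometric[of q], of 0])
     (use norm_binary_term_le in auto)

lemma continuous_on_binary_expansion:
  fixes q :: real
  assumes "0 \<le> q" "q < 1"
  shows "continuous_on binary_sequences (\<lambda>b. \<Sum>n. b n * q ^ n)"
proof (rule uniform_limit_theorem)
  show "uniform_limit binary_sequences (\<lambda>n b. \<Sum>i<n. b i * q ^ i) (\<lambda>b. \<Sum>n. b n * q ^ n) sequentially"
    by (rule Weierstrass_m_test[OF norm_binary_term_le]) (use assms in \<open>auto intro: summable_geometric\<close>)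
  show "\<forall>\<^sub>F n in sequentially. continuous_on binary_sequences (\<lambda>b. \<Sum>i<n. b i * q ^ i)"
    by (intro always_eventually allI continuous_intros continuous_on_product_then_coordinatewise[OF continuous_on_id])
qed simp

text \<open>With digits 0 and 1 in base 3, everything after the leading digit contributes between 0
  and 1/2, less than the gap 1 between two leading digits. So the value determines the leading
  digit, and induction on the shifted sequences gives the others. The image is a scaled copy of the
  Cantor set.\<close>

lemma inj_on_ternary_expansion: "inj_on (\<lambda>b. \<Sum>n. b n * (1/3) ^ n :: real) binary_sequences"
proof (rule inj_onI, rule ext)
  let ?c = "\<lambda>b. \<Sum>n. b n * (1/3) ^ n :: real"
  have bounds: "0 \<le> ?c b \<and> ?c b \<le> 3/2" if "b \<in> binary_sequences" for b
  proof
    show "0 \<le> ?c b"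
    proof (intro suminf_nonneg summable_binary that)
      show "0 \<le> b n * (1/3) ^ n" for n
        using that by (auto simp: binary_sequences_iff dest: spec[of _ n])
    qed auto
    have "?c b \<le> (\<Sum>n. (1/3) ^ n)"
      using that norm_binary_term_le[of b "1/3"]
      by (intro suminf_le summable_binary summable_geometric) (auto simp: abs_le_iff)
    then show "?c b \<le> 3/2" by (simp add: suminf_geometric)
  qed
  have split: "?c b = b 0 + ?c (\<lambda>n. b (Suc n)) / 3" if "b \<in> binary_sequences" for b
    using suminf_split_head[OF summable_binary[OF that, of "1/3"]]
      suminf_mult[OF summable_binary[of "\<lambda>n. b (Suc n)" "1/3"], of "1/3"] that
    by (simp add: binary_sequences_iff mult_ac)
  fix b b' n
  show "b \<in> binary_sequences \<Longrightarrow> b' \<in> binary_sequences \<Longrightarrow> ?c b = ?c b' \<Longrightarrow> b n = b' n"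
  proof (induction n arbitrary: b b')
    case (0 b b')
    have sh: "(\<lambda>n. b (Suc n)) \<in> binary_sequences" "(\<lambda>n. b' (Suc n)) \<in> binary_sequences"
      using 0 by (auto simp: binary_sequences_iff)
    have "b 0 + ?c (\<lambda>n. b (Suc n)) / 3 = b' 0 + ?c (\<lambda>n. b' (Suc n)) / 3"
      using 0(3) split[OF 0(1)] split[OF 0(2)] by simp
    moreover have "b 0 = 0 \<or> b 0 = 1" "b' 0 = 0 \<or> b' 0 = 1"
      using 0 by (auto simp: binary_sequences_iff)
    ultimately show ?case using bounds[OF sh(1)] bounds[OF sh(2)] by linarith
  next
    case (Suc n b b')
    have sh: "(\<lambda>n. b (Suc n)) \<in> binary_sequences" "(\<lambda>n. b' (Suc n)) \<in> binary_sequences"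
      using Suc.prems by (auto simp: binary_sequences_iff)
    have eq: "b 0 + ?c (\<lambda>n. b (Suc n)) / 3 = b' 0 + ?c (\<lambda>n. b' (Suc n)) / 3"
      using Suc.prems(3) split[OF Suc.prems(1)] split[OF Suc.prems(2)] by simp
    moreover have "b 0 = 0 \<or> b 0 = 1" "b' 0 = 0 \<or> b' 0 = 1"
      using Suc.prems by (auto simp: binary_sequences_iff)
    ultimately have "b 0 = b' 0" using bounds[OF sh(1)] bounds[OF sh(2)] by linarith
    then show ?case using Suc.IH[OF sh] eq by simp
  qed
qed

lemma binary_expansion_exists:
  fixes t :: real
  assumes "0 \<le> t" "t < 1"
  shows "\<exists>b\<in>binary_sequences. (\<Sum>n. b n * (1/2) ^ n) = 2 * t"
proof -
  \<comment> \<open>This is the usual binary digit number \<open>n + 1\<close> of \<open>t\<close>;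
    the partial sums telescope. The value is \<open>2 * t\<close> because the leading digit here has
    weight 1 instead of 1/2.\<close>
  define b where "b n = real_of_int (\<lfloor>2 ^ Suc n * t\<rfloor> - 2 * \<lfloor>2 ^ n * t\<rfloor>)" for n
  have "b n = 0 \<or> b n = 1" for n
  proof -
    have "\<lfloor>2 ^ Suc n * t\<rfloor> - 2 * \<lfloor>2 ^ n * t\<rfloor> \<in> {0, 1}"
      by (simp add: mult.assoc) linarith
    then show ?thesis by (auto simp: b_def)
  qed
  then have b: "b \<in> binary_sequences" by (simp add: binary_sequences_iff)
  have partial: "(\<Sum>i<n. b i * (1/2) ^ i) = 2 * (of_int \<lfloor>2 ^ n * t\<rfloor> / 2 ^ n)" for n
  proof (induction n)
    case 0
    have "\<lfloor>t\<rfloor> = 0" using assms by linarith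
    then show ?case by simp
  next
    case (Suc n)
    then show ?case by (simp add: b_def field_simps)
  qed
  have "(\<lambda>n. 2 * (of_int \<lfloor>2 ^ n * t\<rfloor> / 2 ^ n)) \<longlonglongrightarrow> 2 * t"
  proof (rule tendsto_mult_left, rule tendsto_sandwich)
    show "\<forall>\<^sub>F n in sequentially. t - (1/2) ^ n \<le> of_int \<lfloor>2 ^ n * t\<rfloor> / 2 ^ n"
    proof (intro always_eventually allI)
      fix n :: nat
      have "2 ^ n * t - 1 \<le> of_int \<lfloor>2 ^ n * t\<rfloor>" by linarith
      then have "(2 ^ n * t - 1) / 2 ^ n \<le> of_int \<lfloor>2 ^ n * t\<rfloor> / 2 ^ n"
        by (rule divide_right_mono) simp
      then show "t - (1/2) ^ n \<le> of_int \<lfloor>2 ^ n * t\<rfloor> / 2 ^ n"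
        by (simp add: diff_divide_distrib power_divide)
    qed
    show "\<forall>\<^sub>F n in sequentially. of_int \<lfloor>2 ^ n * t\<rfloor> / 2 ^ n \<le> t"
      by (intro always_eventually allI) (simp add: divide_le_eq mult.commute)
    show "(\<lambda>n. t - (1/2) ^ n) \<longlonglongrightarrow> t" by real_asymp
  qed simp
  then have "(\<lambda>n. \<Sum>i<n. b i * (1/2) ^ i) \<longlonglongrightarrow> 2 * t" by (simp only: partial)
  moreover have "(\<lambda>n. \<Sum>i<n. b i * (1/2) ^ i) \<longlonglongrightarrow> (\<Sum>n. b n * (1/2) ^ n)"
    by (intro summable_LIMSEQ summable_binary b) auto
  ultimately show ?thesis using b LIMSEQ_unique by blast
qed

text \<open>A case of the Hausdorff-Alexandroff theorem. Binary digits give a continuous map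
  \<open>h\<close> from the Cantor space whose image contains \<open>X\<close>, and the preimage
  \<open>K'\<close> of \<open>X\<close> is compact. The ternary map \<open>c\<close> embeds
  \<open>K'\<close> into the line, with continuous inverse by compactness, so \<open>h\<close> after
  this inverse is the required map.\<close>

lemma compact_sequence_set_is_real_image:
  fixes X :: "(nat \<Rightarrow> real) set"
  assumes "compact X"
  shows "\<exists>C g. compact (C :: real set) \<and> continuous_on C g \<and> g ` C = X"
proof -
  let ?K = binary_sequences
  define c where "c b = (\<Sum>n. b n * (1/3) ^ n :: real)" for b
  define v where "v b = (\<Sum>n. b n * (1/2) ^ n :: real)" for b
  have cont_c: "continuous_on ?K c" and cont_v: "continuous_on ?K v"
    unfolding c_def v_def by (rule continuous_on_binary_expansion; simp)+
  have "inj_on c ?K" unfolding c_def by (rule inj_on_ternary_expansion)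
  \<comment> \<open>The strict bound makes \<open>a n\<close> positive and puts the rescaled
    coordinate \<open>(x n / a n + 1) / 2\<close> below 1, as \<open>binary_expansion_exists\<close>
    requires.\<close>
  have "\<exists>a. \<forall>x\<in>X. \<bar>x n\<bar> < a" for n
  proof -
    have "compact ((\<lambda>x. x n) ` X)"
      by (rule compact_continuous_image[OF _ assms])
         (rule continuous_on_product_then_coordinatewise[OF continuous_on_id])
    then obtain B where "\<forall>x\<in>X. \<bar>x n\<bar> \<le> B"
      using compact_imp_bounded by (fastforce simp: bounded_iff)
    then show ?thesis by (intro exI[of _ "B + 1"]) force
  qed
  then obtain a where a: "\<And>x n. x \<in> X \<Longrightarrow> \<bar>x n\<bar> < a n" by metis
  \<comment> \<open>The pairing function splits one digit sequence into countably many, one for each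
    coordinate of the point to be coded.\<close>
  define row :: "(nat \<Rightarrow> real) \<Rightarrow> nat \<Rightarrow> nat \<Rightarrow> real"
    where "row b n = (\<lambda>j. b (prod_encode (n, j)))" for b n
  \<comment> \<open>Since \<open>v\<close> takes values in [0, 2], this rescales it to the interval
    from \<open>- a n\<close> to \<open>a n\<close>.\<close>
  define h where "h b n = a n * (v (row b n) - 1)" for b n
  have row: "row b n \<in> ?K" if "b \<in> ?K" for b n
    using that by (auto simp: row_def binary_sequences_iff)
  have cont_row: "continuous_on ?K (\<lambda>b. row b n)" for n
    unfolding row_def
    by (intro continuous_on_coordinatewise_then_product
        continuous_on_product_then_coordinatewise[OF continuous_on_id])
  have cont_h: "continuous_on ?K h"
  proof (rule continuous_on_coordinatewise_then_product)
    show "continuous_on ?K (\<lambda>b. h b n)" for n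
      unfolding h_def
      by (intro continuous_intros continuous_on_compose2[OF cont_v cont_row]) (use row in auto)
  qed
  have surj: "\<exists>b\<in>?K. h b = x" if "x \<in> X" for x
  proof -
    have "\<exists>d\<in>?K. a n * (v d - 1) = x n" for n
    proof -
      have "a n > 0" using a[OF that, of n] by linarith
      have "\<exists>d\<in>?K. v d = 2 * ((x n / a n + 1) / 2)"
        unfolding v_def using a[OF that, of n] \<open>a n > 0\<close>
        by (intro binary_expansion_exists) (auto simp: field_simps)
      then obtain d where "d \<in> ?K" "v d = x n / a n + 1" by auto
      then show ?thesis using \<open>a n > 0\<close> by (intro bexI[of _ d]) auto
    qed
    then obtain d where d: "\<And>n. d n \<in> ?K" "\<And>n. a n * (v (d n) - 1) = x n" by metis
    define b where "b m = (case prod_decode m of (n, j) \<Rightarrow> d n j)" for m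
    have "row b n = d n" for n by (simp add: row_def b_def)
    moreover have "b \<in> ?K"
      using d(1) by (auto simp: b_def binary_sequences_iff split: prod.split)
    ultimately show ?thesis using d(2) by (intro bexI[of _ b]) (auto simp: h_def)
  qed
  define K' where "K' = {b \<in> ?K. h b \<in> X}"
  have "closedin (top_of_set ?K) K'"
    unfolding K'_def
    using continuous_closedin_preimage[OF cont_h compact_imp_closed[OF assms]]
    by (simp add: vimage_def Int_def)
  then have "compact K'" using compact_binary_sequences closedin_compact by blast
  have sub: "K' \<subseteq> ?K" by (auto simp: K'_def)
  define g where "g = h \<circ> the_inv_into K' c"
  have inj: "inj_on c K'" using \<open>inj_on c ?K\<close> sub by (rule inj_on_subset)
  have cont_inv: "continuous_on (c ` K') (the_inv_into K' c)"
    by (rule continuous_on_inv_into[OF _ \<open>compact K'\<close> inj]) (rule continuous_on_subset[OF cont_c sub])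
  show ?thesis
  proof (intro exI[of _ "c ` K'"] exI[of _ g] conjI)
    show "compact (c ` K')"
      by (rule compact_continuous_image[OF continuous_on_subset[OF cont_c sub] \<open>compact K'\<close>])
    show "continuous_on (c ` K') g"
      unfolding g_def
      by (intro continuous_on_compose cont_inv continuous_on_subset[OF cont_h])
         (use sub in \<open>auto simp: the_inv_into_f_f[OF inj]\<close>)
    have "g ` c ` K' = h ` K'"
      unfolding g_def image_comp[symmetric] the_inv_into_onto[OF inj] by simp
    also have "\<dots> = X" using surj by (force simp: K'_def)
    finally show "g ` c ` K' = X" .
  qed
qed

section \<open>Weak limits of finitely or countably supported measures on a compact set\<close>

text \<open>The measures are lifted along \<open>g\<close> to a compact set \<open>C\<close> of
  reals, where boundedness gives tightness and hence a weak limit \<open>Q\<close> of a subsequence.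
  As \<open>C\<close> is closed, \<open>Q\<close> is concentrated on \<open>C\<close>, and its image
  under \<open>g\<close> is \<open>P\<close>.\<close>

lemma weak_limit_on_compact:
  fixes X :: "(nat \<Rightarrow> real) set" and p :: "nat \<Rightarrow> (nat \<Rightarrow> real) pmf"
  assumes "compact X" and supp: "\<And>k. set_pmf (p k) \<subseteq> X"
  shows "\<exists>P r. strict_mono (r :: nat \<Rightarrow> nat) \<and> borel_prob_on X P \<and>
    (\<forall>f :: (nat \<Rightarrow> real) \<Rightarrow> real. continuous_on X f \<longrightarrow>
       (\<lambda>k. measure_pmf.expectation (p (r k)) f) \<longlonglongrightarrow> (\<integral>x. f x \<partial>P))"
proof -
  obtain C :: "real set" and g where C: "compact C" and g: "continuous_on C g" and im: "g ` C = X"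
    using compact_sequence_set_is_real_image[OF \<open>compact X\<close>] by blast
  \<comment> \<open>The choice function \<open>inv_into C g\<close> may fail to be Borel, which is
    harmless here: for a \<open>pmf\<close> every set is measurable.\<close>
  define q where "q k = map_pmf (inv_into C g) (p k)" for k
  have q_supp: "set_pmf (q k) \<subseteq> C" for k
    using supp[of k] inv_into_into[of _ g C] im by (force simp: q_def)
  have "map_pmf g (q k) = p k" for k
    unfolding q_def map_pmf_comp
    by (rule map_pmf_idI) (use supp[of k] im f_inv_into_f[of _ g C] in auto)
  then have p_eq: "p k = map_pmf g (q k)" for k by simp
  define \<mu> where "\<mu> k = distr (measure_pmf (q k)) borel (\<lambda>x. x)" for k
  have rd: "real_distribution (\<mu> k)" for k
    unfolding \<mu>_def by (rule prob_space.real_distribution_distr[OF prob_space_measure_pmf]) simp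
  have \<mu>_int: "integral\<^sup>L (\<mu> k) f = measure_pmf.expectation (q k) f"
    if "f \<in> borel_measurable borel" for k and f :: "real \<Rightarrow> real"
    unfolding \<mu>_def using that by (subst integral_distr) auto
  obtain B where B: "B > 0" "\<And>x. x \<in> C \<Longrightarrow> \<bar>x\<bar> < B"
    using compact_imp_bounded[OF C] by (auto simp: bounded_pos_less)
  have "tight \<mu>"
    unfolding tight_def
  proof (intro conjI allI impI rd)
    fix e :: real assume "e > 0"
    have "measure (\<mu> k) {-B<..B} = 1" for k
    proof -
      have "measure (\<mu> k) {-B<..B} = measure (measure_pmf (q k)) {-B<..B}"
        unfolding \<mu>_def by (subst measure_distr) auto
      also have "\<dots> = 1"
        using q_supp[of k] B(2) by (subst measure_pmf.prob_eq_1) (force simp: AE_measure_pmf_iff)+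
      finally show ?thesis .
    qed
    then show "\<exists>a b. a < b \<and> (\<forall>k. 1 - e < measure (\<mu> k) {a<..b})"
      using \<open>e > 0\<close> \<open>B > 0\<close> by (intro exI[of _ "-B"] exI[of _ B]) auto
  qed
  then obtain r Q where r: "strict_mono (r :: nat \<Rightarrow> nat)" and Q: "real_distribution Q"
    and "weak_conv_m (\<mu> \<circ> id \<circ> r) Q"
    using tight_imp_convergent_subsubsequence[of \<mu> id] by (auto simp: strict_mono_def)
  then have weak: "weak_conv_m (\<lambda>k. \<mu> (r k)) Q" by (simp add: comp_def)
  interpret Q: real_distribution Q by fact
  have conv: "(\<lambda>k. measure_pmf.expectation (q (r k)) f) \<longlonglongrightarrow> integral\<^sup>L Q f"
    if "continuous_on UNIV f" "\<And>x. \<bar>f x\<bar> \<le> b" for f :: "real \<Rightarrow> real" and b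
  proof -
    have "(\<lambda>k. integral\<^sup>L (\<mu> (r k)) f) \<longlonglongrightarrow> integral\<^sup>L Q f"
      by (rule weak_conv_imp_integral_bdd_continuous_conv[OF rd Q weak, where B = b])
         (use that in \<open>auto simp: continuous_on_eq_continuous_at\<close>)
    then show ?thesis using that(1) by (simp add: \<mu>_int borel_measurable_continuous_onI)
  qed
  have "closed C" using C by (rule compact_imp_closed)
  then have C_sets[measurable]: "C \<in> sets borel" by (rule borel_closed)
  have "C \<noteq> {}" using q_supp[of 0] set_pmf_not_empty[of "q 0"] by auto
  have AE_C: "AE t in Q. t \<in> C"
  proof -
    \<comment> \<open>A continuous function vanishing exactly on \<open>C\<close>, truncated at 1
      because weak convergence is tested against bounded functions.\<close>
    define d where "d t = min 1 (infdist t C)" for t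
    have cont_d: "continuous_on UNIV d" unfolding d_def by (intro continuous_intros)
    have meas_d: "d \<in> borel_measurable borel" using cont_d by (rule borel_measurable_continuous_onI)
    have d_bd: "0 \<le> d t" "\<bar>d t\<bar> \<le> 1" for t by (auto simp: d_def infdist_nonneg)
    have "measure_pmf.expectation (q k) d = 0" for k
      using q_supp[of k] by (intro integral_eq_zero_AE) (auto simp: AE_measure_pmf_iff d_def)
    then have "integral\<^sup>L Q d = 0" using conv[OF cont_d d_bd(2)] by (simp add: LIMSEQ_const_iff)
    moreover have "integrable Q d"
      using d_bd meas_d by (intro Q.integrable_const_bound[where B = 1]) auto
    ultimately have "AE t in Q. d t = 0"
      using integral_nonneg_eq_0_iff_AE[of Q d] d_bd by simp
    then show ?thesis
      by eventually_elim
         (use in_closed_iff_infdist_zero[OF \<open>closed C\<close> \<open>C \<noteq> {}\<close>] in \<open>auto simp: d_def min_def split: if_splits\<close>)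
  qed
  have Q_C: "emeasure Q C = 1" using AE_C by (intro Q.emeasure_eq_1_AE) auto
  \<comment> \<open>The map \<open>g\<close> is continuous only on \<open>C\<close>, so
    \<open>Q\<close> is restricted to \<open>C\<close> before it is pushed forward.\<close>
  define QC where "QC = restrict_space Q C"
  have C_Q: "C \<inter> space Q \<in> sets Q" by simp
  interpret QC: prob_space QC
    unfolding QC_def by (rule prob_space_restrict_space) (use Q_C in auto)
  have sets_QC: "sets QC = sets (restrict_space borel C)"
    unfolding QC_def by (intro sets_restrict_space_cong) simp
  have g_meas: "g \<in> QC \<rightarrow>\<^sub>M restrict_space borel X"
  proof (rule measurable_restrict_space2)
    show "g \<in> space QC \<rightarrow> X" using im by (auto simp: QC_def space_restrict_space)
    show "g \<in> borel_measurable QC"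
      using borel_measurable_continuous_on_restrict[OF g]
      by (simp cong: measurable_cong_sets add: sets_QC)
  qed
  define P where "P = distr QC (restrict_space borel X) g"
  have "borel_prob_on X P"
    unfolding borel_prob_on_def P_def using QC.prob_space_distr[OF g_meas] by simp
  moreover have "(\<lambda>k. measure_pmf.expectation (p (r k)) f) \<longlonglongrightarrow> (\<integral>x. f x \<partial>P)"
    if f: "continuous_on X f" for f :: "(nat \<Rightarrow> real) \<Rightarrow> real"
  proof -
    have fg: "continuous_on C (\<lambda>t. f (g t))"
      using continuous_on_compose2[OF f g] im by auto
    obtain b where b: "b > 0" "\<And>t. t \<in> C \<Longrightarrow> norm (f (g t)) \<le> b"
      using compact_imp_bounded[OF compact_continuous_image[OF fg C]] by (auto simp: bounded_pos)
    \<comment> \<open>Weak convergence on the line needs a bounded continuous function on all of it,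
      whereas \<open>f\<close> composed with \<open>g\<close> is controlled only on
      \<open>C\<close>.\<close>
    obtain F where F: "continuous_on UNIV F" "\<And>t. t \<in> C \<Longrightarrow> F t = f (g t)" "\<And>t. norm (F t) \<le> b"
      using Tietze[OF fg, of UNIV b] b \<open>closed C\<close> by auto
    have F_meas: "F \<in> borel_measurable borel" using F(1) by (rule borel_measurable_continuous_onI)
    have "measure_pmf.expectation (p k) f = measure_pmf.expectation (q k) F" for k
      unfolding p_eq using subsetD[OF q_supp[of k]]
      by (auto simp: AE_measure_pmf_iff F(2) intro!: integral_cong_AE)
    moreover have "(\<integral>x. f x \<partial>P) = integral\<^sup>L Q F"
    proof -
      have f_meas: "f \<in> borel_measurable (restrict_space borel X)"
        using f by (rule borel_measurable_continuous_on_restrict)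
      have "(\<integral>x. f x \<partial>P) = (\<integral>t. f (g t) \<partial>QC)"
        unfolding P_def by (rule integral_distr[OF g_meas f_meas])
      also have "\<dots> = (\<integral>t. F t \<partial>QC)"
        by (rule Bochner_Integration.integral_cong) (auto simp: F(2) QC_def space_restrict_space)
      also have "\<dots> = (\<integral>t. indicator C t *\<^sub>R F t \<partial>Q)"
        unfolding QC_def by (rule integral_restrict_space[OF C_Q])
      also have "\<dots> = integral\<^sup>L Q F"
        using AE_C F_meas by (intro integral_cong_AE) auto
      finally show ?thesis .
    qed
    ultimately show ?thesis using conv[OF F(1), of b] F(3) by simp
  qed
  ultimately show ?thesis using r by blast
qed

section \<open>Power of tests and the minimax argument\<close>

context
  fixes M :: "'a measure" and Z :: "'a \<Rightarrow> nat \<Rightarrow> real"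
  assumes M: "prob_space M" and Z [measurable]: "Z \<in> borel_measurable M"
begin

interpretation M: prob_space M by (rule M)

text \<open>For \<open>\<phi>\<close> with values in [0, 1], this is the power of a randomized test
  against the signal \<open>x\<close>; at the zero signal it is the probability of a false
  alarm.\<close>

definition shifted_expectation :: "((nat \<Rightarrow> real) \<Rightarrow> real) \<Rightarrow> (nat \<Rightarrow> real) \<Rightarrow> real" where
  "shifted_expectation \<phi> x = (\<integral>\<omega>. \<phi> (\<lambda>n. x n + Z \<omega> n) \<partial>M)"

lemma measurable_shifted_noise [measurable]: "(\<lambda>\<omega> n. x n + Z \<omega> n) \<in> borel_measurable M"
  by (intro measurable_coordinatewise_then_product borel_measurable_add
      measurable_product_then_coordinatewise[OF Z] borel_measurable_const)

lemma measurable_signal_plus_noise: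
  assumes "sets P = sets (restrict_space borel X)"
  shows "(\<lambda>(x, \<omega>) n. x n + Z \<omega> n) \<in> borel_measurable (P \<Otimes>\<^sub>M M)"
proof -
  have "(\<lambda>x. x) \<in> borel_measurable P"
    unfolding measurable_cong_sets[OF assms refl]
    by (rule measurable_restrict_space1[OF measurable_ident_sets[OF refl]])
  from measurable_product_then_coordinatewise[OF measurable_compose[OF measurable_fst this]]
  have "(\<lambda>z. fst z n) \<in> borel_measurable (P \<Otimes>\<^sub>M M)" for n .
  moreover from measurable_product_then_coordinatewise[OF measurable_compose[OF measurable_snd Z]]
  have "(\<lambda>z. Z (snd z) n) \<in> borel_measurable (P \<Otimes>\<^sub>M M)" for n .
  ultimately show ?thesis
    unfolding split_beta by (intro measurable_coordinatewise_then_product borel_measurable_add)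
qed

lemma shifted_integrable:
  assumes "continuous_on UNIV \<phi>" "range \<phi> \<subseteq> {0..1::real}"
  shows "integrable M (\<lambda>\<omega>. \<phi> (\<lambda>n. x n + Z \<omega> n))"
proof -
  have [measurable]: "\<phi> \<in> borel_measurable borel"
    using assms(1) by (rule borel_measurable_continuous_onI)
  show ?thesis
    by (rule M.integrable_const_bound[where B = 1]) (use assms(2) in \<open>auto simp: image_subset_iff\<close>)
qed

lemma shifted_expectation_bounds:
  assumes "continuous_on UNIV \<phi>" "range \<phi> \<subseteq> {0..1}"
  shows "0 \<le> shifted_expectation \<phi> x" "shifted_expectation \<phi> x \<le> 1"
proof -
  show "0 \<le> shifted_expectation \<phi> x"
    unfolding shifted_expectation_def using assms(2)
    by (intro Bochner_Integration.integral_nonneg) (auto simp: image_subset_iff)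
  show "shifted_expectation \<phi> x \<le> 1"
    unfolding shifted_expectation_def
    by (rule M.integral_le_const[OF shifted_integrable[OF assms]])
       (use assms(2) in \<open>auto simp: image_subset_iff\<close>)
qed

text \<open>Dominated convergence along sequences. Continuity in the signal is what lets the power
  of a test pass to a weak limit of measures on signals.\<close>

lemma continuous_on_shifted_expectation:
  assumes "continuous_on UNIV \<phi>" "range \<phi> \<subseteq> {0..1}"
  shows "continuous_on UNIV (shifted_expectation \<phi>)"
  unfolding continuous_on_sequentially
proof (intro allI ballI impI, elim conjE)
  fix y x assume y: "y \<longlonglongrightarrow> (x :: nat \<Rightarrow> real)"
  have [measurable]: "\<phi> \<in> borel_measurable borel"
    using assms(1) by (rule borel_measurable_continuous_onI)
  have "continuous_on UNIV (\<lambda>x n. x n + z n :: real)" for z :: "nat \<Rightarrow> real"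
    by (intro continuous_on_coordinatewise_then_product continuous_intros
        continuous_on_product_then_coordinatewise[OF continuous_on_id])
  then have "continuous_on UNIV (\<lambda>x. \<phi> (\<lambda>n. x n + z n))" for z
    using continuous_on_compose2[OF assms(1)] by blast
  then have "(\<lambda>k. \<phi> (\<lambda>n. y k n + z n)) \<longlonglongrightarrow> \<phi> (\<lambda>n. x n + z n)" for z
    by (rule continuous_on_tendsto_compose[OF _ y]) auto
  then have "(\<lambda>k. shifted_expectation \<phi> (y k)) \<longlonglongrightarrow> shifted_expectation \<phi> x"
    unfolding shifted_expectation_def
    by (intro integral_dominated_convergence[where w = "\<lambda>_. 1"])
       (use assms(2) in \<open>auto simp: image_subset_iff\<close>)
  then show "(shifted_expectation \<phi> \<circ> y) \<longlonglongrightarrow> shifted_expectation \<phi> x" by (simp add: comp_def)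
qed

text \<open>Lets a weighted average of tests be treated as a single test. For \<open>W = 0\<close>
  both sides are 0 by the convention for division.\<close>

lemma shifted_expectation_sum:
  assumes "\<And>i. continuous_on UNIV (\<phi> i)" "\<And>i. range (\<phi> i) \<subseteq> {0..1}"
  shows "shifted_expectation (\<lambda>y. (\<Sum>i<k. w i * \<phi> i y) / W) x
    = (\<Sum>i<k. w i * shifted_expectation (\<phi> i) x) / W"
  unfolding shifted_expectation_def
  using shifted_integrable[OF assms] by simp

lemma integral_signal_plus_noise:
  assumes P: "borel_prob_on X P" and \<phi>: "continuous_on UNIV \<phi>" "range \<phi> \<subseteq> {0..1}"
  shows "(\<integral>y. \<phi> y \<partial>distr (P \<Otimes>\<^sub>M M) borel (\<lambda>(x, \<omega>) n. x n + Z \<omega> n)) = (\<integral>x. shifted_expectation \<phi> x \<partial>P)"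
proof -
  interpret P: prob_space P using P by (simp add: borel_prob_on_def)
  interpret PM: pair_prob_space P M ..
  have meas [measurable]: "(\<lambda>(x, \<omega>) n. x n + Z \<omega> n) \<in> borel_measurable (P \<Otimes>\<^sub>M M)"
    using P by (intro measurable_signal_plus_noise) (simp add: borel_prob_on_def)
  have [measurable]: "\<phi> \<in> borel_measurable borel"
    using \<phi>(1) by (rule borel_measurable_continuous_onI)
  have "integrable (P \<Otimes>\<^sub>M M) (\<lambda>z. \<phi> ((\<lambda>(x, \<omega>) n. x n + Z \<omega> n) z))"
    by (rule PM.integrable_const_bound[where B = 1]) (use \<phi>(2) in \<open>auto simp: image_subset_iff\<close>)
  from PM.integral_fst'[OF this]
  have "(\<integral>z. \<phi> ((\<lambda>(x, \<omega>) n. x n + Z \<omega> n) z) \<partial>(P \<Otimes>\<^sub>M M)) = (\<integral>x. shifted_expectation \<phi> x \<partial>P)"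
    by (simp add: shifted_expectation_def)
  then show ?thesis by (subst integral_distr) auto
qed

text \<open>Singularity supplies a separating set that may depend on \<open>P\<close>, whereas one
  test must serve all signals. If every test has gain at most \<open>1 - e\<close> at some signal, a
  measure \<open>P\<close> is found under which each test of the countable family has average gain
  at most \<open>1 - e\<close>. Singularity for this \<open>P\<close> contradicts that, with
  \<open>e\<close> split evenly between the two kinds of error.\<close>

lemma singular_imp_test:
  assumes X: "compact X"
    and sing: "\<And>P. borel_prob_on X P \<Longrightarrow>
      mutually_singular (distr M borel Z) (distr (P \<Otimes>\<^sub>M M) borel (\<lambda>(x, \<omega>) n. x n + Z \<omega> n))"
    and e: "0 < e" "e < 1"
  shows "\<exists>\<phi>. continuous_on UNIV \<phi> \<and> range \<phi> \<subseteq> {0..1} \<and>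
    (\<forall>x\<in>X. shifted_expectation \<phi> x - shifted_expectation \<phi> (\<lambda>_. 0) > 1 - e)"
proof (rule ccontr)
  define D where "D \<phi> x = shifted_expectation \<phi> x - shifted_expectation \<phi> (\<lambda>_. 0)" for \<phi> x
  assume "\<not> ?thesis"
  then have fail: "\<exists>x\<in>X. D \<phi> x \<le> 1 - e" if "continuous_on UNIV \<phi>" "range \<phi> \<subseteq> {0..1}" for \<phi>
    using that unfolding D_def by (meson not_le)
  obtain \<phi> :: "nat \<Rightarrow> (nat \<Rightarrow> real) \<Rightarrow> real"
    where \<phi>: "\<And>i. continuous_on UNIV (\<phi> i)" "\<And>i. range (\<phi> i) \<subseteq> {0..1}"
      and \<phi>_approx: "\<And>K \<mu> e. compact K \<Longrightarrow> K \<noteq> {} \<Longrightarrow> finite_measure \<mu> \<Longrightarrow> sets \<mu> = sets borel \<Longrightarrow> e > 0 \<Longrightarrow>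
        \<exists>i. (\<forall>y\<in>K. \<phi> i y = 1) \<and> (\<integral>y. \<phi> i y \<partial>\<mu>) < measure \<mu> K + e"
    using countable_test_family by metis
  \<comment> \<open>Normalized by their sum, the weights turn the tests into one averaged test, to
    which \<open>fail\<close> applies. If all weights vanish, the average is the zero test and any
    point of \<open>X\<close> will do.\<close>
  have response: "\<exists>x\<in>X. (\<Sum>i<k. w i * (D (\<phi> i) x - (1 - e))) \<le> 0" if w: "\<And>i. 0 \<le> w i" for k w
  proof -
    define W where "W = (\<Sum>i<k. w i)"
    have "W \<ge> 0" unfolding W_def using w by (intro sum_nonneg) auto
    define \<psi> where "\<psi> = (\<lambda>y. (\<Sum>i<k. w i * \<phi> i y) / W)"
    have "continuous_on UNIV \<psi>"
    proof (cases "W = 0")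
      case False
      then show ?thesis unfolding \<psi>_def by (intro continuous_intros \<phi>) auto
    qed (simp add: \<psi>_def)
    moreover have "range \<psi> \<subseteq> {0..1}"
    proof (rule image_subsetI)
      fix y
      have "0 \<le> (\<Sum>i<k. w i * \<phi> i y)" "(\<Sum>i<k. w i * \<phi> i y) \<le> W"
        using w \<phi>(2) unfolding W_def
        by (auto simp: image_subset_iff intro!: sum_nonneg sum_mono mult_left_le)
      then show "\<psi> y \<in> {0..1}"
        using \<open>W \<ge> 0\<close> by (auto simp: \<psi>_def divide_le_eq_1 order_le_less)
    qed
    ultimately obtain x where x: "x \<in> X" "D \<psi> x \<le> 1 - e" using fail by blast
    have "(\<Sum>i<k. w i * D (\<phi> i) x) \<le> W * (1 - e)"
    proof (cases "W = 0")
      case True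
      then have "\<And>i. i < k \<Longrightarrow> w i = 0" using w by (simp add: W_def sum_nonneg_eq_0_iff)
      then show ?thesis using True by simp
    next
      case False
      have "D \<psi> x = (\<Sum>i<k. w i * D (\<phi> i) x) / W"
        unfolding D_def \<psi>_def shifted_expectation_sum[OF \<phi>]
        by (simp add: right_diff_distrib sum_subtractf diff_divide_distrib)
      then show ?thesis using x(2) False \<open>W \<ge> 0\<close> by (simp add: divide_le_eq mult.commute)
    qed
    then show ?thesis
      using x(1) by (intro bexI[of _ x])
        (auto simp: right_diff_distrib sum_subtractf W_def sum_distrib_right)
  qed
  \<comment> \<open>\<open>p\<close> is the empirical measure of the first \<open>N\<close>
    responses in Blackwell's strategy; the number of tests grows with \<open>k\<close> while the
    error shrinks.\<close>
  have "\<exists>p. set_pmf p \<subseteq> X \<and> (\<forall>i<k. measure_pmf.expectation p (D (\<phi> i)) \<le> 1 - e + 1 / (real k + 1))" for k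
  proof -
    have "\<exists>N xs. N > 0 \<and> (\<forall>t. xs t \<in> X) \<and>
        (\<forall>i<k. (\<Sum>t<N. D (\<phi> i) (xs t) - (1 - e)) \<le> 1 / (real k + 1) * real N)"
    \<comment> \<open>\<open>D\<close> has values in [-1, 1], and \<open>1 - e\<close> lies between
      0 and 1.\<close>
    proof (rule approachability[where B = 2])
      show "\<bar>D (\<phi> i) x - (1 - e)\<bar> \<le> 2" for i x
        using shifted_expectation_bounds[OF \<phi>, of i x] shifted_expectation_bounds[OF \<phi>, of i "\<lambda>_. 0"] e
        unfolding D_def by linarith
    qed (use response in auto)
    then obtain N xs where N: "N > 0" "\<And>t. xs t \<in> X"
      and regret: "\<And>i. i < k \<Longrightarrow> (\<Sum>t<N. D (\<phi> i) (xs t) - (1 - e)) \<le> 1 / (real k + 1) * real N"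
      by blast
    define p where "p = map_pmf xs (pmf_of_set {..<N})"
    have "measure_pmf.expectation p (D (\<phi> i)) \<le> 1 - e + 1 / (real k + 1)" if "i < k" for i
    proof -
      have "measure_pmf.expectation p (D (\<phi> i)) = (\<Sum>t<N. D (\<phi> i) (xs t)) / real N"
        unfolding p_def using N(1) by (simp add: integral_pmf_of_set lessThan_empty_iff)
      also have "\<dots> \<le> 1 - e + 1 / (real k + 1)"
      proof -
        have "(\<Sum>t<N. D (\<phi> i) (xs t)) \<le> (1 - e + 1 / (real k + 1)) * real N"
          using regret[OF that] unfolding sum_subtractf by (simp add: algebra_simps)
        then show ?thesis using N(1) by (subst pos_divide_le_eq) auto
      qed
      finally show ?thesis .
    qed
    moreover have "set_pmf p \<subseteq> X" using N by (auto simp: p_def)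
    ultimately show ?thesis by blast
  qed
  then obtain p where p: "\<And>k. set_pmf (p k) \<subseteq> X"
    and p_le: "\<And>k i. i < k \<Longrightarrow> measure_pmf.expectation (p k) (D (\<phi> i)) \<le> 1 - e + 1 / (real k + 1)"
    by metis
  obtain P r where r: "strict_mono (r :: nat \<Rightarrow> nat)" and P: "borel_prob_on X P"
    and lim: "\<And>f :: (nat \<Rightarrow> real) \<Rightarrow> real. continuous_on X f \<Longrightarrow>
       (\<lambda>k. measure_pmf.expectation (p (r k)) f) \<longlonglongrightarrow> (\<integral>x. f x \<partial>P)"
    using weak_limit_on_compact[where p = p, OF X p] by metis
  interpret P: prob_space P using P by (simp add: borel_prob_on_def)
  interpret PM: pair_prob_space P M ..
  have cont_E: "continuous_on X (shifted_expectation (\<phi> i))" for i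
    using continuous_on_shifted_expectation[OF \<phi>] by (rule continuous_on_subset) simp
  \<comment> \<open>For fixed \<open>i\<close>, the index \<open>r k\<close> eventually exceeds
    \<open>i\<close>, so the bound on \<open>p (r k)\<close> applies from then on and its slack
    vanishes in the limit.\<close>
  have P_le: "(\<integral>x. shifted_expectation (\<phi> i) x \<partial>P) - shifted_expectation (\<phi> i) (\<lambda>_. 0) \<le> 1 - e" for i
  proof -
    have "shifted_expectation (\<phi> i) \<in> borel_measurable P"
      using borel_measurable_continuous_on_restrict[OF cont_E] P
      by (simp cong: measurable_cong_sets add: borel_prob_on_def)
    then have "integrable P (shifted_expectation (\<phi> i))"
      using shifted_expectation_bounds[OF \<phi>] by (intro P.integrable_const_bound[where B = 1]) auto
    then have "(\<integral>x. D (\<phi> i) x \<partial>P) = (\<integral>x. shifted_expectation (\<phi> i) x \<partial>P) - shifted_expectation (\<phi> i) (\<lambda>_. 0)"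
      unfolding D_def by (simp add: P.prob_space)
    moreover have "(\<integral>x. D (\<phi> i) x \<partial>P) \<le> 1 - e"
    proof (rule LIMSEQ_le)
      show "(\<lambda>k. measure_pmf.expectation (p (r k)) (D (\<phi> i))) \<longlonglongrightarrow> (\<integral>x. D (\<phi> i) x \<partial>P)"
        by (rule lim) (auto simp: D_def intro!: continuous_intros cont_E)
      have "(\<lambda>k. 1 - e + 1 / (real k + 1)) \<longlonglongrightarrow> 1 - e" by real_asymp
      from LIMSEQ_subseq_LIMSEQ[OF this r]
      show "(\<lambda>k. 1 - e + 1 / (real (r k) + 1)) \<longlonglongrightarrow> 1 - e" by (simp add: comp_def)
      have "i < r k" if "k \<ge> Suc i" for k using seq_suble[OF r, of k] that by linarith
      then show "\<exists>N. \<forall>k\<ge>N. measure_pmf.expectation (p (r k)) (D (\<phi> i)) \<le> 1 - e + 1 / (real (r k) + 1)"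
        using p_le by blast
    qed
    ultimately show ?thesis by simp
  qed
  define \<mu> where "\<mu> = distr M borel Z"
  define \<nu> where "\<nu> = distr (P \<Otimes>\<^sub>M M) borel (\<lambda>(x, \<omega>) n. x n + Z \<omega> n)"
  interpret \<mu>: prob_space \<mu> unfolding \<mu>_def by (rule M.prob_space_distr) simp
  interpret \<nu>: prob_space \<nu>
    unfolding \<nu>_def using P
    by (intro PM.prob_space_distr measurable_signal_plus_noise) (simp add: borel_prob_on_def)
  have sets_\<mu>: "sets \<mu> = sets borel" and sets_\<nu>: "sets \<nu> = sets borel"
    by (simp_all add: \<mu>_def \<nu>_def)
  obtain A where A: "A \<in> sets borel" "emeasure \<mu> A = 0" "emeasure \<nu> (space \<nu> - A) = 0"
    using sing[OF P] unfolding mutually_singular_def \<mu>_def[symmetric] \<nu>_def[symmetric] sets_\<mu> by blast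
  have "emeasure \<nu> A = 1"
  proof -
    have "\<nu>.prob (space \<nu> - A) = 0" using A(3) by (simp add: measure_def)
    then have "\<nu>.prob A = 1" using \<nu>.prob_compl[of A] A(1) sets_\<nu> by simp
    then show ?thesis by (simp add: \<nu>.emeasure_eq_measure)
  qed
  \<comment> \<open>Inner regularity of finite Borel measures on a Polish space replaces
    \<open>A\<close> by a compact subset, which is still null for \<open>\<mu>\<close> and is the
    kind of set the test family separates.\<close>
  also have "emeasure \<nu> A = (SUP K \<in> {K. K \<subseteq> A \<and> compact K}. emeasure \<nu> K)"
    using sets_\<nu> A(1) by (intro inner_regular) auto
  finally have "ennreal (1 - e / 2) < (SUP K \<in> {K. K \<subseteq> A \<and> compact K}. emeasure \<nu> K)"
    using e by (metis diff_less_eq ennreal_less_one_iff half_gt_zero less_add_same_cancel1)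
  then obtain K where K: "K \<subseteq> A" "compact K" and "ennreal (1 - e / 2) < emeasure \<nu> K"
    by (auto simp: less_SUP_iff)
  then have \<nu>_K: "1 - e / 2 < measure \<nu> K"
    using e by (simp add: \<nu>.emeasure_eq_measure ennreal_less_iff)
  then have "K \<noteq> {}" using e by auto
  have "emeasure \<mu> K = 0" using emeasure_mono[of K A \<mu>] A K sets_\<mu> by simp
  then have \<mu>_K: "measure \<mu> K = 0" by (simp add: measure_def)
  \<comment> \<open>This test has false alarm probability below \<open>e / 2\<close> and, being 1 on
    \<open>K\<close>, average power above \<open>1 - e / 2\<close>; its gain then exceeds the bound
    in \<open>P_le\<close>.\<close>
  obtain i where i: "\<And>y. y \<in> K \<Longrightarrow> \<phi> i y = 1" "(\<integral>y. \<phi> i y \<partial>\<mu>) < measure \<mu> K + e / 2"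
    using \<phi>_approx[OF K(2) \<open>K \<noteq> {}\<close> \<mu>.finite_measure_axioms sets_\<mu>, of "e / 2"] e by auto
  have \<phi>_meas: "\<phi> i \<in> borel_measurable borel" using \<phi>(1) by (rule borel_measurable_continuous_onI)
  have K_sets: "K \<in> sets \<nu>" using K(2) sets_\<nu> by (simp add: borel_compact)
  have "measure \<nu> K = (\<integral>y. indicator K y \<partial>\<nu>)"
    using K_sets sets.sets_into_space by (simp add: Int_absorb2)
  also have "\<dots> \<le> (\<integral>y. \<phi> i y \<partial>\<nu>)"
  proof (rule integral_mono)
    show "integrable \<nu> (indicator K :: _ \<Rightarrow> real)"
      using K_sets by (intro integrable_real_indicator) (auto simp: \<nu>.emeasure_eq_measure)
    show "integrable \<nu> (\<phi> i)"
      using \<phi>(2)[of i] \<phi>_meas sets_\<nu>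
      by (intro \<nu>.integrable_const_bound[where B = 1])
         (auto simp: image_subset_iff cong: measurable_cong_sets)
    show "indicator K y \<le> \<phi> i y" for y
      using i(1)[of y] \<phi>(2)[of i] by (auto simp: indicator_def image_subset_iff)
  qed
  finally have "1 - e / 2 < (\<integral>x. shifted_expectation (\<phi> i) x \<partial>P)"
    using \<nu>_K integral_signal_plus_noise[OF P \<phi>, of i] unfolding \<nu>_def by linarith
  moreover have "shifted_expectation (\<phi> i) (\<lambda>_. 0) < e / 2"
    using i(2)[unfolded \<mu>_K] \<phi>_meas
    by (simp add: \<mu>_def shifted_expectation_def integral_distr)
  ultimately show False using P_le[of i] by linarith
qed

end

section \<open>The two implications\<close>

text \<open>Borel-Cantelli in terms of expectations: the sum of the \<open>f n\<close> has finite
  expectation, hence is finite almost surely, and the terms of a convergent series tend to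
  0.\<close>

lemma (in prob_space) AE_tendsto_zero_of_summable_expectation:
  fixes f :: "nat \<Rightarrow> 'a \<Rightarrow> real"
  assumes int: "\<And>n. integrable M (f n)" and nonneg: "\<And>n \<omega>. 0 \<le> f n \<omega>"
    and "summable b" and bound: "\<And>n. expectation (f n) \<le> b n"
  shows "AE \<omega> in M. (\<lambda>n. f n \<omega>) \<longlonglongrightarrow> 0"
proof -
  have [measurable]: "f n \<in> borel_measurable M" for n using int by auto
  have nn: "(\<integral>\<^sup>+\<omega>. ennreal (f n \<omega>) \<partial>M) = ennreal (expectation (f n))" for n
    using int nonneg by (intro nn_integral_eq_integral) auto
  have exp_nonneg: "0 \<le> expectation (f n)" for n
    using nonneg by (intro Bochner_Integration.integral_nonneg)
  have summ: "summable (\<lambda>n. expectation (f n))"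
    by (rule summable_comparison_test'[OF \<open>summable b\<close>, of 0]) (use exp_nonneg bound in auto)
  have "(\<integral>\<^sup>+\<omega>. (\<Sum>n. ennreal (f n \<omega>)) \<partial>M) = (\<Sum>n. ennreal (expectation (f n)))"
    by (simp add: nn_integral_suminf nn)
  also have "\<dots> = ennreal (\<Sum>n. expectation (f n))"
    using summ exp_nonneg by (intro suminf_ennreal2) auto
  finally have "AE \<omega> in M. (\<Sum>n. ennreal (f n \<omega>)) \<noteq> \<infinity>"
    by (intro nn_integral_noteq_infinite) auto
  then show ?thesis
  proof eventually_elim
    case (elim \<omega>)
    then have "summable (\<lambda>n. f n \<omega>)" using nonneg by (intro summable_suminf_not_top) auto
    then show ?case by (rule summable_LIMSEQ_zero)
  qed
qed

text \<open>The null set on which detection fails may vary with \<open>x\<close>, but all its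
  sections being null makes the joint failure set null for the product of \<open>P\<close> and
  \<open>M\<close>.\<close>

lemma admits_detection_imp_singular:
  assumes M: "prob_space M" and \<xi>: "(\<lambda>\<omega> n. \<xi> n \<omega>) \<in> borel_measurable M"
    and det: "admits_detection M \<xi> X" and P: "borel_prob_on X P"
  shows "mutually_singular (noise_dist M \<xi>) (signal_plus_noise_dist M \<xi> P)"
proof -
  interpret M: prob_space M by (rule M)
  interpret P: prob_space P using P by (simp add: borel_prob_on_def)
  interpret PM: pair_prob_space P M ..
  obtain T :: "(nat \<Rightarrow> real) \<Rightarrow> nat" where T: "T \<in> borel \<rightarrow>\<^sub>M count_space {0, 1}"
    and T0: "AE \<omega> in M. T (\<lambda>n. \<xi> n \<omega>) = 0"
    and T1: "\<And>x. x \<in> X \<Longrightarrow> AE \<omega> in M. T (\<lambda>n. x n + \<xi> n \<omega>) = 1"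
    using det unfolding admits_detection_def by blast
  define A where "A = {y. T y = 1}"
  have A[measurable]: "A \<in> sets borel"
    using measurable_sets[OF T, of "{1}"] by (simp add: A_def vimage_def)
  have meas[measurable]: "(\<lambda>(x, \<omega>) n. x n + \<xi> n \<omega>) \<in> borel_measurable (P \<Otimes>\<^sub>M M)"
    using measurable_signal_plus_noise[OF M \<xi>] P by (simp add: borel_prob_on_def)
  have "{y \<in> space borel. y \<notin> A} \<in> sets borel" by measurable
  from AE_distr_iff[OF \<xi> this] have "AE y in noise_dist M \<xi>. y \<notin> A"
    unfolding noise_dist_def using T0 by (auto simp: A_def elim!: eventually_mono)
  then have 0: "emeasure (noise_dist M \<xi>) A = 0"
    by (subst (asm) AE_iff_measurable[of A]) (auto simp: noise_dist_def)
  have "AE z in P \<Otimes>\<^sub>M M. (\<lambda>(x, \<omega>) n. x n + \<xi> n \<omega>) z \<in> A"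
  proof (rule PM.AE_pair_measure)
    \<comment> \<open>\<open>T1\<close> speaks only of points of \<open>X\<close>; since
      \<open>X\<close> is the whole space of \<open>P\<close>, it covers every \<open>x\<close> that
      can be sampled.\<close>
    have "space P = X"
      using P sets_eq_imp_space_eq[of P "restrict_space borel X"]
      by (simp add: borel_prob_on_def space_restrict_space)
    then show "AE x in P. AE \<omega> in M. (\<lambda>(x, \<omega>) n. x n + \<xi> n \<omega>) (x, \<omega>) \<in> A"
      by (intro AE_I2[of P]) (simp add: A_def T1[simplified])
  qed measurable
  then have "AE y in signal_plus_noise_dist M \<xi> P. y \<in> A"
    unfolding signal_plus_noise_dist_def by (subst AE_distr_iff[OF meas]) auto
  then have "emeasure (signal_plus_noise_dist M \<xi> P) (space (signal_plus_noise_dist M \<xi> P) - A) = 0"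
    by (subst (asm) AE_iff_measurable[of "space (signal_plus_noise_dist M \<xi> P) - A"])
       (auto simp: signal_plus_noise_dist_def)
  with 0 A show ?thesis by (auto simp: mutually_singular_def noise_dist_def)
qed

text \<open>Power and false alarm probability both lie in [0, 1], so a gain above
  \<open>1 - e\<close> bounds both errors by \<open>e\<close>. Summable errors then give almost sure
  limits: 0 under pure noise, 1 under every signal.\<close>

lemma singular_imp_admits_detection:
  assumes M: "prob_space M" and \<xi>: "(\<lambda>\<omega> n. \<xi> n \<omega>) \<in> borel_measurable M" and "compact X"
    and sing: "\<And>P. borel_prob_on X P \<Longrightarrow>
      mutually_singular (noise_dist M \<xi>) (signal_plus_noise_dist M \<xi> P)"
  shows "admits_detection M \<xi> X"
\<comment> \<open>A gain bound is available only at a signal, so bounding the false alarms takes a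
  point of \<open>X\<close>. With no signals, the constant 0 detects.\<close>
proof (cases "X = {}")
  case True
  then show ?thesis
    unfolding admits_detection_def by (intro exI[of _ "\<lambda>_. 0"]) auto
next
  case False
  then obtain x0 where "x0 \<in> X" by blast
  interpret M: prob_space M by (rule M)
  let ?E = "shifted_expectation M (\<lambda>\<omega> n. \<xi> n \<omega>)"
  \<comment> \<open>The exponent starts at 1 because \<open>singular_imp_test\<close> requires an
    error strictly below 1.\<close>
  let ?e = "\<lambda>k::nat. (1/2) ^ Suc k :: real"
  have e: "0 < ?e k" "?e k < 1" for k
    using power_Suc_less_one[of "1/2 :: real" k] by auto
  have "\<exists>\<phi>. continuous_on UNIV \<phi> \<and> range \<phi> \<subseteq> {0..1} \<and> (\<forall>x\<in>X. ?E \<phi> x - ?E \<phi> (\<lambda>_. 0) > 1 - ?e k)" for k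
    by (rule singular_imp_test[OF M \<xi> \<open>compact X\<close> _ e])
       (use sing in \<open>simp add: noise_dist_def signal_plus_noise_dist_def\<close>)
  then obtain \<phi> :: "nat \<Rightarrow> (nat \<Rightarrow> real) \<Rightarrow> real"
    where cont: "\<And>k. continuous_on UNIV (\<phi> k)" and rng: "\<And>k. range (\<phi> k) \<subseteq> {0..1}"
      and gap: "\<And>k x. x \<in> X \<Longrightarrow> ?E (\<phi> k) x - ?E (\<phi> k) (\<lambda>_. 0) > 1 - ?e k"
    by metis
  have [measurable]: "\<phi> k \<in> borel_measurable borel" for k
    using cont by (rule borel_measurable_continuous_onI)
  note bounds = shifted_expectation_bounds[OF M \<xi> cont rng]
  note integrable = shifted_integrable[OF M \<xi> cont rng]
  have summ: "summable ?e" by (simp add: summable_geometric summable_mult)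
  \<comment> \<open>Convergence to 1 is a single Borel event defined without reference to a signal,
    so one \<open>T\<close> serves all of \<open>X\<close>.\<close>
  define T :: "(nat \<Rightarrow> real) \<Rightarrow> nat" where "T y = (if (\<lambda>k. \<phi> k y) \<longlonglongrightarrow> 1 then 1 else 0)" for y
  show ?thesis
    unfolding admits_detection_def
  proof (intro exI[of _ T] conjI ballI)
    have "{y. (\<lambda>k. \<phi> k y) \<longlonglongrightarrow> 1} \<in> sets borel" by measurable
    then show "T \<in> borel \<rightarrow>\<^sub>M count_space {0, 1}"
      unfolding T_def by (intro measurable_If) (auto simp: pred_def)
  next
    have "AE \<omega> in M. (\<lambda>k. \<phi> k (\<lambda>n. 0 + \<xi> n \<omega>)) \<longlonglongrightarrow> 0"
    proof (rule M.AE_tendsto_zero_of_summable_expectation[OF integrable _ summ])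
      show "M.expectation (\<lambda>\<omega>. \<phi> k (\<lambda>n. 0 + \<xi> n \<omega>)) \<le> ?e k" for k
        using gap[OF \<open>x0 \<in> X\<close>, of k] bounds(2)[of k x0]
        unfolding shifted_expectation_def[OF M \<xi>] by simp
    qed (use rng in \<open>auto simp: image_subset_iff\<close>)
    then show "AE \<omega> in M. T (\<lambda>n. \<xi> n \<omega>) = 0"
    proof eventually_elim
      case (elim \<omega>)
      then have "\<not> (\<lambda>k. \<phi> k (\<lambda>n. \<xi> n \<omega>)) \<longlonglongrightarrow> 1"
        using LIMSEQ_unique[of "\<lambda>k. \<phi> k (\<lambda>n. \<xi> n \<omega>)" 0 1] by auto
      then show ?case by (simp add: T_def)
    qed
  next
    fix x assume "x \<in> X"
    have "AE \<omega> in M. (\<lambda>k. 1 - \<phi> k (\<lambda>n. x n + \<xi> n \<omega>)) \<longlonglongrightarrow> 0"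
    proof (rule M.AE_tendsto_zero_of_summable_expectation[OF _ _ summ])
      show "M.expectation (\<lambda>\<omega>. 1 - \<phi> k (\<lambda>n. x n + \<xi> n \<omega>)) \<le> ?e k" for k
        using gap[OF \<open>x \<in> X\<close>, of k] bounds(1)[of k "\<lambda>_. 0"] integrable[of k x]
        unfolding shifted_expectation_def[OF M \<xi>] by (simp add: M.prob_space)
    qed (use rng integrable in \<open>auto simp: image_subset_iff\<close>)
    then show "AE \<omega> in M. T (\<lambda>n. x n + \<xi> n \<omega>) = 1"
    proof eventually_elim
      case (elim \<omega>)
      from tendsto_diff[OF tendsto_const[of 1] elim] show ?case by (simp add: T_def)
    qed
  qed
qed

theorem theorem3p2:
  fixes M :: "'a measure" and \<xi> :: "nat \<Rightarrow> 'a \<Rightarrow> real" and X :: "(nat \<Rightarrow> real) set"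
  assumes "gaussian_noise M \<xi>"
    and "compact X"
  shows "admits_detection M \<xi> X \<longleftrightarrow>
    (\<forall>P. borel_prob_on X P \<longrightarrow>
       mutually_singular (noise_dist M \<xi>) (signal_plus_noise_dist M \<xi> P))"
proof -
  have M: "prob_space M" using assms(1) by (simp add: gaussian_noise_def)
  have "distributed M lborel (\<xi> n) std_normal_density" for n
    using assms(1) by (simp add: gaussian_noise_def)
  then have "\<xi> n \<in> borel_measurable M" for n
    using distributed_measurable[of M lborel "\<xi> n"] by simp
  then have "(\<lambda>\<omega> n. \<xi> n \<omega>) \<in> borel_measurable M"
    by (rule measurable_coordinatewise_then_product)
  then show ?thesis
    using admits_detection_imp_singular[OF M] singular_imp_admits_detection[OF M _ assms(2)] by blast
qed

end
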